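(* Let $(X,p)$ be a partial metric space, $r\ge 0$, and let $\{x_{n_k}\}$ be a subsequence of a sequence $\{x_n\}$ in $X$. Then $LIM^{r}x_n\subseteq LIM^{r}x_{n_k}$.
   Context: A partial metric on a nonempty set $X$ is a function $p:X\times X\to[0,\infty)$ such that for all $x,y,z\in X$: (p1) $0\le p(x,x)\le p(x,y)$; (p2) $x=y \iff p(x,x)=p(x,y)=p(y,y)$; (p3) $p(x,y)=p(y,x)$; (p4) $p(x,y)\le p(x,z)+p(z,y)-p(z,z)$. The pair $(X,p)$ is a partial metric space. For a real number $r\ge 0$, a sequence $\{x_n\}$ in $X$ is $r$-convergent to $x\in X$ if for every $\epsilon>0$ there is $k\in\mathbb{N}$ such that $|p(x_n,x)-p(x,x)|<r+\epsilon$ for all $n\ge k$. $LIM^{r}x_n$ is the set of all $x\in X$ such that $\{x_n\}$ is $r$-convergent to $x$. *)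

theory Defs
  imports Complex_Main
begin

text \<open>The axioms are relativised to the carrier \<open>X\<close>; the values of \<open>p\<close> outside
  \<open>X \<times> X\<close> are irrelevant.\<close>

locale partial_metric_space =
  fixes X :: "'a set" and p :: "'a \<Rightarrow> 'a \<Rightarrow> real"
  assumes nonempty: "X \<noteq> {}"
    and nonneg: "\<And>x y. x \<in> X \<Longrightarrow> y \<in> X \<Longrightarrow> 0 \<le> p x y"
    and p1: "\<And>x y. x \<in> X \<Longrightarrow> y \<in> X \<Longrightarrow> 0 \<le> p x x \<and> p x x \<le> p x y"
    and p2: "\<And>x y. x \<in> X \<Longrightarrow> y \<in> X \<Longrightarrow> x = y \<longleftrightarrow> p x x = p x y \<and> p x y = p y y"
    and p3: "\<And>x y. x \<in> X \<Longrightarrow> y \<in> X \<Longrightarrow> p x y = p y x"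
    and p4: "\<And>x y z. x \<in> X \<Longrightarrow> y \<in> X \<Longrightarrow> z \<in> X \<Longrightarrow> p x y \<le> p x z + p z y - p z z"

definition r_convergent :: "('a \<Rightarrow> 'a \<Rightarrow> real) \<Rightarrow> real \<Rightarrow> (nat \<Rightarrow> 'a) \<Rightarrow> 'a \<Rightarrow> bool"
  where "r_convergent p r s x \<longleftrightarrow>
    (\<forall>\<epsilon>>0. \<exists>k. \<forall>n\<ge>k. \<bar>p (s n) x - p x x\<bar> < r + \<epsilon>)"

definition LIM_r :: "'a set \<Rightarrow> ('a \<Rightarrow> 'a \<Rightarrow> real) \<Rightarrow> real \<Rightarrow> (nat \<Rightarrow> 'a) \<Rightarrow> 'a set"
  where "LIM_r X p r s = {x \<in> X. r_convergent p r s x}"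

end

theory Submission
  imports Defs
begin

text \<open>A strictly increasing index map never falls behind the identity:
  \<open>n \<le> \<nu> n\<close> (\<open>seq_suble\<close>). Hence a threshold \<open>k\<close> that
  serves \<epsilon> for \<open>s\<close> also serves \<epsilon> for the subsequence, since
  \<open>k \<le> n\<close> gives \<open>k \<le> \<nu> n\<close>.\<close>

lemma r_convergent_subseq:
  assumes "r_convergent p r s x" and "strict_mono \<nu>"
  shows "r_convergent p r (\<lambda>k. s (\<nu> k)) x"
  using assms unfolding r_convergent_def by (meson order_trans seq_suble)

theorem theorem3p10:
  fixes X :: "'a set" and p :: "'a \<Rightarrow> 'a \<Rightarrow> real" and r :: real
    and x :: "nat \<Rightarrow> 'a" and \<nu> :: "nat \<Rightarrow> nat"
  assumes "partial_metric_space X p"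
    and "r \<ge> 0"
    and "\<And>n. x n \<in> X"
    and "strict_mono \<nu>"
  shows "LIM_r X p r x \<subseteq> LIM_r X p r (\<lambda>k. x (\<nu> k))"
  \<comment> \<open>Membership of the limit point in \<open>X\<close> does not depend on the
    sequence, so only \<open>r_convergent\<close> has to pass to the subsequence.\<close>
  using assms(4) by (auto simp: LIM_r_def intro: r_convergent_subseq)

end
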